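(* Let $F = GF(p^n)$, where $p$ is a prime. If $G$ denotes the group \[ \left\lbrace V(a, b, c) = \begin{bmatrix} 1 & 0 & 0\\ a & 1 & 0\\ b & c & 1 \end{bmatrix} : a, b, c \in F \right\rbrace \] under matrix multiplication $V(a, b, c)V(a', b', c') = V(a + a', b + b' + ca', c + c')$, then \[ E(\Gamma_G) = LE(\Gamma_G) = LE^+(\Gamma_G) = 2(p^{3n} - 2p^n - 1). \]
   Context: For a finite non-abelian group $G$ with center $Z(G)$, the commuting graph $\Gamma_G$ is the simple undirected graph with vertex set $G \setminus Z(G)$ in which two distinct vertices $x, y$ are adjacent iff $xy = yx$. For a finite graph $\mathcal{G}$ with vertex set $v(\mathcal{G})$, edge set $e(\mathcal{G})$, adjacency matrix $A$ and (diagonal) degree matrix $D$, put $L = D - A$ and $Q = D + A$. With all sums over eigenvalues counted with multiplicity: the energy is $E(\mathcal{G}) = \sum |\lambda|$ over eigenvalues $\lambda$ of $A$; the Laplacian energy is $LE(\mathcal{G}) = \sum \left|\mu - \frac{2|e(\mathcal{G})|}{|v(\mathcal{G})|}\right|$ over eigenvalues $\mu$ of $L$; the signless Laplacian energy is $LE^+(\mathcal{G}) = \sum \left|\nu - \frac{2|e(\mathcal{G})|}{|v(\mathcal{G})|}\right|$ over eigenvalues $\nu$ of $Q$. *)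

theory Defs
  imports
    "HOL-Algebra.Group"
    "HOL-Computational_Algebra.Primes"
    "HOL-Library.Cardinality"
    "Jordan_Normal_Form.Spectral_Radius"
begin

section \<open>Graph energies\<close>

record 'a sgraph =
  vertices :: "'a set"
  edges :: "'a set set"  \<comment> \<open>unordered pairs of distinct vertices\<close>

text \<open>
  The matrices of a finite graph are written with respect to an arbitrarily chosen
  enumeration of the vertices. A different enumeration conjugates them by a permutation
  matrix, so their eigenvalues and multiplicities do not depend on it.
\<close>

definition vertex_enum :: "'a sgraph \<Rightarrow> 'a list" where
  "vertex_enum \<G> = (SOME xs. distinct xs \<and> set xs = vertices \<G>)"

lemma vertex_enum:
  assumes "finite (vertices \<G>)"
  shows "distinct (vertex_enum \<G>)" and "set (vertex_enum \<G>) = vertices \<G>"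
    and "length (vertex_enum \<G>) = card (vertices \<G>)"
proof -
  have "\<exists>xs. distinct xs \<and> set xs = vertices \<G>"
    using finite_distinct_list[OF assms] by blast
  from someI_ex[OF this] show *: "distinct (vertex_enum \<G>)" "set (vertex_enum \<G>) = vertices \<G>"
    unfolding vertex_enum_def by auto
  show "length (vertex_enum \<G>) = card (vertices \<G>)"
    using * distinct_card by metis
qed

definition vertex_degree :: "'a sgraph \<Rightarrow> 'a \<Rightarrow> nat" where
  "vertex_degree \<G> x = card {e \<in> edges \<G>. x \<in> e}"

definition adjacency_mat :: "'a sgraph \<Rightarrow> complex mat" where
  "adjacency_mat \<G> =
    mat (card (vertices \<G>)) (card (vertices \<G>))
      (\<lambda>(i, j). if {vertex_enum \<G> ! i, vertex_enum \<G> ! j} \<in> edges \<G> then 1 else 0)"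

definition degree_mat :: "'a sgraph \<Rightarrow> complex mat" where
  "degree_mat \<G> =
    mat (card (vertices \<G>)) (card (vertices \<G>))
      (\<lambda>(i, j). if i = j then of_nat (vertex_degree \<G> (vertex_enum \<G> ! i)) else 0)"

definition laplacian_mat :: "'a sgraph \<Rightarrow> complex mat" where
  "laplacian_mat \<G> = degree_mat \<G> - adjacency_mat \<G>"

definition signless_laplacian_mat :: "'a sgraph \<Rightarrow> complex mat" where
  "signless_laplacian_mat \<G> = degree_mat \<G> + adjacency_mat \<G>"

text \<open>
  Sum of \<open>f\<close> over the eigenvalues, each counted with its algebraic multiplicity. The
  matrices are taken over the complex numbers, so no eigenvalue is left out; for the real
  symmetric matrices above the algebraic and geometric multiplicities coincide.
\<close>

definition eigenvalue_sum :: "(complex \<Rightarrow> real) \<Rightarrow> complex mat \<Rightarrow> real" where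
  "eigenvalue_sum f M =
    (\<Sum>\<alpha>\<in>spectrum M. real (Polynomial.order \<alpha> (char_poly M)) * f \<alpha>)"

definition average_degree :: "'a sgraph \<Rightarrow> real" where
  "average_degree \<G> = 2 * real (card (edges \<G>)) / real (card (vertices \<G>))"

definition energy :: "'a sgraph \<Rightarrow> real" where
  "energy \<G> = eigenvalue_sum cmod (adjacency_mat \<G>)"

definition laplacian_energy :: "'a sgraph \<Rightarrow> real" where
  "laplacian_energy \<G> =
    eigenvalue_sum (\<lambda>\<mu>. cmod (\<mu> - complex_of_real (average_degree \<G>))) (laplacian_mat \<G>)"

definition signless_laplacian_energy :: "'a sgraph \<Rightarrow> real" where
  "signless_laplacian_energy \<G> =
    eigenvalue_sum (\<lambda>\<nu>. cmod (\<nu> - complex_of_real (average_degree \<G>)))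
      (signless_laplacian_mat \<G>)"

section \<open>Commuting graphs\<close>

definition center :: "('a, 'b) monoid_scheme \<Rightarrow> 'a set" where
  "center G = {z \<in> carrier G. \<forall>x\<in>carrier G. z \<otimes>\<^bsub>G\<^esub> x = x \<otimes>\<^bsub>G\<^esub> z}"

definition commuting_graph :: "('a, 'b) monoid_scheme \<Rightarrow> 'a sgraph" where
  "commuting_graph G =
    \<lparr>vertices = carrier G - center G,
     edges = {{x, y} | x y. x \<in> carrier G - center G \<and> y \<in> carrier G - center G \<and>
                x \<noteq> y \<and> x \<otimes>\<^bsub>G\<^esub> y = y \<otimes>\<^bsub>G\<^esub> x}\<rparr>"

section \<open>The group of lower unitriangular matrices of size three\<close>

definition V :: "'F::field \<Rightarrow> 'F \<Rightarrow> 'F \<Rightarrow> 'F mat" where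
  "V a b c = mat_of_rows_list 3
    [[1, 0, 0],
     [a, 1, 0],
     [b, c, 1]]"

definition unitriangular_group :: "'F::field mat monoid" where
  "unitriangular_group = \<lparr>carrier = {V a b c | a b c. True}, mult = (*), one = 1\<^sub>m 3\<rparr>"

lemma V_mult: "V a b c * V a' b' c' = V (a + a') (b + b' + c * a') (c + c')"
  by (rule eq_matI)
    (auto simp: V_def mat_of_rows_list_def scalar_prod_def less_Suc_eq numeral_3_eq_3
      algebra_simps)

lemma V_zero: "V 0 0 0 = 1\<^sub>m 3"
  by (rule eq_matI)
    (auto simp: V_def mat_of_rows_list_def less_Suc_eq numeral_3_eq_3)

lemma group_unitriangular_group: "group (unitriangular_group :: 'F::field mat monoid)"
proof (rule groupI)
  fix x :: "'F mat"
  assume "x \<in> carrier unitriangular_group"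
  then obtain a b c where x: "x = V a b c"
    by (auto simp: unitriangular_group_def)
  have "V (- a) (c * a - b) (- c) * x = V 0 0 0"
    by (simp add: x V_mult)
  then show "\<exists>y\<in>carrier unitriangular_group. y \<otimes>\<^bsub>unitriangular_group\<^esub> x = \<one>\<^bsub>unitriangular_group\<^esub>"
    by (auto simp: unitriangular_group_def V_zero)
qed (auto 0 4 simp: unitriangular_group_def V_mult V_zero[symmetric] algebra_simps)

end

theory Submission
  imports Defs
begin

text \<open>
  Two non-central elements \<open>V a b c\<close> and \<open>V a' b' c'\<close> commute iff \<open>(a, c)\<close> and \<open>(a', c')\<close> span
  the same line of \<open>F\<^sup>2\<close>, so with \<open>q = |F|\<close> the commuting graph is a disjoint union of cliques of
  size \<open>m = q\<^sup>2 - q\<close>. Every eigenvalue of its adjacency matrix \<open>A\<close> is \<open>-1\<close> or \<open>m - 1\<close>. On these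
  two values the absolute value agrees with an affine function, so the energy depends only on
  the number of vertices and on the trace of \<open>A\<close>, which is zero; multiplicities are never needed.
  The graph is regular of degree \<open>d = m - 1\<close>, so \<open>L - d = -A\<close> and \<open>Q - d = A\<close>, and all three
  energies agree.
\<close>

section \<open>Sums over eigenvalues\<close>

lemma trace_mult_commute:
  fixes A B :: "'a::comm_semiring_0 mat"
  assumes "A \<in> carrier_mat n m" "B \<in> carrier_mat m n"
  shows "(\<Sum>i<n. (A * B) $$ (i, i)) = (\<Sum>i<m. (B * A) $$ (i, i))"
proof -
  have "(\<Sum>i<n. (A * B) $$ (i, i)) = (\<Sum>i<n. \<Sum>j<m. A $$ (i, j) * B $$ (j, i))"
    using assms by (auto intro!: sum.cong simp: scalar_prod_def lessThan_atLeast0)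
  also have "\<dots> = (\<Sum>j<m. \<Sum>i<n. B $$ (j, i) * A $$ (i, j))"
    by (subst sum.swap) (simp add: mult.commute)
  also have "\<dots> = (\<Sum>i<m. (B * A) $$ (i, i))"
    using assms by (auto intro!: sum.cong simp: scalar_prod_def lessThan_atLeast0)
  finally show ?thesis .
qed

lemma trace_similar:
  fixes A B :: "'a::comm_ring_1 mat"
  assumes A: "A \<in> carrier_mat n n" and "similar_mat_wit A B P Q"
  shows "(\<Sum>i<n. A $$ (i, i)) = (\<Sum>i<n. B $$ (i, i))"
proof -
  note s = similar_mat_witD2[OF assms]
  have "(\<Sum>i<n. A $$ (i, i)) = (\<Sum>i<n. (P * (B * Q)) $$ (i, i))"
    using s by (simp add: assoc_mult_mat)
  also have "\<dots> = (\<Sum>i<n. ((B * Q) * P) $$ (i, i))"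
    using s by (intro trace_mult_commute) auto
  also have "(B * Q) * P = B"
    using s by (simp add: assoc_mult_mat)
  finally show ?thesis .
qed

text \<open>Schur decomposition: \<open>A\<close> is similar to a matrix \<open>B\<close> whose
  diagonal lists the roots, and similarity preserves the trace.\<close>

lemma trace_eq_sum_list_roots:
  fixes A :: "'a::conjugatable_ordered_field mat"
  assumes A: "A \<in> carrier_mat n n" and c: "char_poly A = (\<Prod>a\<leftarrow>as. [:- a, 1:])"
  shows "(\<Sum>i<n. A $$ (i, i)) = sum_list as"
proof -
  obtain B P Q where B: "schur_decomposition A as = (B, P, Q)"
    by (cases "schur_decomposition A as") auto
  from schur_decomposition[OF A c B]
  have sim: "similar_mat_wit A B P Q" and d: "diag_mat B = as" by auto
  have "dim_row B = n" using similar_mat_witD2[OF A sim] by auto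
  then have "sum_list as = (\<Sum>i<n. B $$ (i, i))"
    by (simp add: d[symmetric] diag_mat_def sum_list_sum_nth lessThan_atLeast0)
  then show ?thesis using trace_similar[OF A sim] by simp
qed

text \<open>Turns algebraic multiplicities into repetitions in a list of roots, so that
  \<open>eigenvalue_sum\<close> becomes a plain list sum.\<close>

lemma order_prod_linear_factors:
  "Polynomial.order x (\<Prod>a\<leftarrow>as. [:- a, 1:]) = count_list as (x :: 'a::idom)"
proof (induction as)
  case (Cons a as)
  have "Polynomial.order x ([:- a, 1:] * (\<Prod>a\<leftarrow>as. [:- a, 1:])) =
      Polynomial.order x [:- a, 1:] + Polynomial.order x (\<Prod>a\<leftarrow>as. [:- a, 1:])"
    by (rule order_mult) (auto simp: prod_list_zero_iff simp del: mult_pCons_left)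
  moreover have "Polynomial.order x [:- a, 1:] = (if a = x then 1 else 0)"
    using order_linear_power[of x "- a" 1] by simp
  ultimately show ?case using Cons.IH by simp
qed (simp add: order_0I)

lemma sum_list_map_eq_sum_count_list:
  fixes f :: "'a \<Rightarrow> 'b::semiring_1"
  assumes "finite S" "set xs \<subseteq> S"
  shows "sum_list (map f xs) = (\<Sum>x\<in>S. of_nat (count_list xs x) * f x)"
  using assms(2)
proof (induction xs)
  case (Cons y ys)
  have "(\<Sum>x\<in>S. of_nat (count_list (y # ys) x) * f x) =
      (\<Sum>x\<in>S. (if x = y then f y else 0) + of_nat (count_list ys x) * f x)"
    by (intro sum.cong) (auto simp: algebra_simps)
  also have "\<dots> = f y + (\<Sum>x\<in>S. of_nat (count_list ys x) * f x)"
    using Cons.prems assms(1) by (simp add: sum.distrib)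
  finally show ?case using Cons by simp
qed simp

text \<open>There are \<open>n\<close> roots with repetition and their sum is the trace, so an
  affine summand makes individual multiplicities irrelevant. Agreement with the affine function is
  required at eigenvalues only.\<close>

lemma eigenvalue_sum_affine:
  assumes A: "A \<in> carrier_mat n n"
    and f: "\<And>\<mu>. eigenvalue A \<mu> \<Longrightarrow> complex_of_real (f \<mu>) = u + v * \<mu>"
  shows "complex_of_real (eigenvalue_sum f A) = u * of_nat n + v * (\<Sum>i<n. A $$ (i, i))"
proof -
  obtain as where c: "char_poly A = (\<Prod>a\<leftarrow>as. [:- a, 1:])" and len: "length as = n"
    using char_poly_factorized[OF A] by blast
  have sp: "spectrum A = set as"
    by (auto simp: spectrum_def eigenvalue_root_char_poly[OF A] c poly_prod_list prod_list_zero_iff)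
  have "eigenvalue_sum f A = sum_list (map f as)"
    unfolding eigenvalue_sum_def sp c order_prod_linear_factors
    by (rule sum_list_map_eq_sum_count_list[symmetric]) auto
  also have "complex_of_real \<dots> = sum_list (map (\<lambda>\<mu>. complex_of_real (f \<mu>)) as)"
    by (induction as) auto
  also have "\<dots> = sum_list (map (\<lambda>\<mu>. u + v * \<mu>) as)"
    using sp f by (intro arg_cong[where f = sum_list] map_cong) (auto simp: spectrum_def)
  also have "\<dots> = u * of_nat n + v * sum_list as"
    by (simp add: sum_list_addf sum_list_const_mult sum_list_triv len)
  finally show ?thesis
    by (simp add: trace_eq_sum_list_roots[OF A c])
qed

section \<open>Matrices of the form \<open>c + s A\<close>\<close>

lemma smult_mat_mult_vec:
  assumes "dim_vec x = dim_col A"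
  shows "(k \<cdot>\<^sub>m A) *\<^sub>v x = k \<cdot>\<^sub>v (A *\<^sub>v x)"
  using assms by (intro eq_vecI) (auto simp: scalar_prod_def sum_distrib_left mult.assoc)

lemma eigenvalue_affine_mat:
  fixes A :: "'a::field mat"
  assumes A: "A \<in> carrier_mat n n" and s: "s \<noteq> 0"
    and ev: "eigenvalue (c \<cdot>\<^sub>m 1\<^sub>m n + s \<cdot>\<^sub>m A) \<mu>"
  shows "eigenvalue A ((\<mu> - c) / s)"
proof -
  obtain x where x: "x \<in> carrier_vec n" "x \<noteq> 0\<^sub>v n"
    and eq: "(c \<cdot>\<^sub>m 1\<^sub>m n + s \<cdot>\<^sub>m A) *\<^sub>v x = \<mu> \<cdot>\<^sub>v x"
    using ev A by (auto simp: eigenvalue_def eigenvector_def)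
  have split: "(c \<cdot>\<^sub>m 1\<^sub>m n + s \<cdot>\<^sub>m A) *\<^sub>v x = c \<cdot>\<^sub>v x + s \<cdot>\<^sub>v (A *\<^sub>v x)"
    using A x by (simp add: add_mult_distrib_mat_vec[where nr = n and nc = n] smult_mat_mult_vec)
  have "A *\<^sub>v x = ((\<mu> - c) / s) \<cdot>\<^sub>v x"
  proof (rule eq_vecI)
    fix i assume "i < dim_vec (((\<mu> - c) / s) \<cdot>\<^sub>v x)"
    then have i: "i < n" using x by simp
    have "(c \<cdot>\<^sub>v x + s \<cdot>\<^sub>v (A *\<^sub>v x)) $ i = (\<mu> \<cdot>\<^sub>v x) $ i"
      using eq split by simp
    then have "c * x $ i + s * (A *\<^sub>v x) $ i = \<mu> * x $ i"
      using i x A by simp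
    then show "(A *\<^sub>v x) $ i = (((\<mu> - c) / s) \<cdot>\<^sub>v x) $ i"
      using i x s by (simp add: field_simps)
  qed (use A x in auto)
  then show ?thesis using A x by (auto simp: eigenvalue_def eigenvector_def)
qed

lemma eigenvalue_sum_affine_mat:
  fixes m :: nat
  assumes A: "A \<in> carrier_mat n n" and tr: "(\<Sum>i<n. A $$ (i, i)) = 0"
    and ev: "\<And>\<theta>. eigenvalue A \<theta> \<Longrightarrow> \<theta> = -1 \<or> \<theta> = of_nat m - 1"
    and m: "m \<ge> 1" and s: "cmod s = 1"
  shows "eigenvalue_sum (\<lambda>\<mu>. cmod (\<mu> - c)) (c \<cdot>\<^sub>m 1\<^sub>m n + s \<cdot>\<^sub>m A) =
    2 * real n * (real m - 1) / real m"
proof -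
  let ?M = "c \<cdot>\<^sub>m 1\<^sub>m n + s \<cdot>\<^sub>m A"
  \<comment> \<open>Interpolation of the modulus at the two eigenvalues: \<open>u - v = 1\<close>
    and \<open>u + v * (m - 1) = m - 1\<close>.\<close>
  define u v :: complex where "u = 2 * (of_nat m - 1) / of_nat m" and "v = (of_nat m - 2) / of_nat m"
  have s0: "s \<noteq> 0" using s by auto
  have M: "?M \<in> carrier_mat n n" using A by simp
  have f: "complex_of_real (cmod (\<mu> - c)) = (u - v * c / s) + v / s * \<mu>" if "eigenvalue ?M \<mu>" for \<mu>
  proof -
    define l where "l = (\<mu> - c) / s"
    have l: "l = -1 \<or> l = of_nat m - 1"
      using ev[OF eigenvalue_affine_mat[OF A s0 that]] by (simp add: l_def)
    from l have "complex_of_real (cmod l) = u + v * l"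
    proof
      assume "l = -1"
      then show ?thesis using m by (simp add: u_def v_def divide_simps)
    next
      assume lm: "l = of_nat m - 1"
      \<comment> \<open>Here \<open>m \<ge> 1\<close> enters: \<open>m - 1\<close> is nonnegative
        and hence its own modulus.\<close>
      then have "cmod l = real m - 1"
        using m by (metis norm_of_nat of_nat_1 of_nat_diff)
      then have "complex_of_real (cmod l) = l" using lm by simp
      then show ?thesis using lm m by (simp add: u_def v_def divide_simps) (simp add: algebra_simps)
    qed
    moreover have "cmod l = cmod (\<mu> - c)" by (simp add: l_def norm_divide s)
    ultimately show ?thesis by (simp add: l_def diff_divide_distrib algebra_simps)
  qed
  \<comment> \<open>The trace of \<open>?M\<close> comes from the shift alone; its contribution
    \<open>v / s * n * c\<close> cancels the term \<open>- v * c / s\<close> summed \<open>n\<close>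
    times, leaving \<open>u * n\<close>.\<close>
  have "(\<Sum>i<n. ?M $$ (i, i)) = (\<Sum>i<n. c + s * A $$ (i, i))"
    using A by (intro sum.cong) auto
  also have "\<dots> = of_nat n * c"
    using tr by (simp add: sum.distrib flip: sum_distrib_left)
  finally have "complex_of_real (eigenvalue_sum (\<lambda>\<mu>. cmod (\<mu> - c)) ?M) = u * of_nat n"
    using eigenvalue_sum_affine[OF M f] s0 by (simp add: field_simps)
  also have "\<dots> = complex_of_real (2 * real n * (real m - 1) / real m)"
    by (simp add: u_def)
  finally show ?thesis by (simp only: of_real_eq_iff)
qed

section \<open>Disjoint unions of cliques of equal size\<close>

text \<open>The cliques are the classes of \<open>R\<close>. Since \<open>R\<close> is reflexive and
  edges are not loops, a class of size \<open>m\<close> gives degree \<open>m - 1\<close>.\<close>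

locale clique_union =
  fixes \<G> :: "'a sgraph" and R :: "('a \<times> 'a) set" and m :: nat
  assumes finite_vertices: "finite (vertices \<G>)"
    and vertices_nonempty: "vertices \<G> \<noteq> {}"
    and equiv: "equiv (vertices \<G>) R"
    and edges_eq: "edges \<G> = {{x, y} | x y. (x, y) \<in> R \<and> x \<noteq> y}"
    and card_class: "x \<in> vertices \<G> \<Longrightarrow> card (R `` {x}) = m"
begin

abbreviation "N \<equiv> card (vertices \<G>)"
abbreviation "vx \<equiv> (!) (vertex_enum \<G>)"

lemma R_sym: "(x, y) \<in> R \<Longrightarrow> (y, x) \<in> R"
  using equiv by (auto simp: equiv_def dest: symD)

lemma R_trans: "(x, y) \<in> R \<Longrightarrow> (y, z) \<in> R \<Longrightarrow> (x, z) \<in> R"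
  using equiv by (auto simp: equiv_def dest: transD)

lemma R_refl: "x \<in> vertices \<G> \<Longrightarrow> (x, x) \<in> R"
  using equiv by (auto simp: equiv_def refl_on_def)

lemma R_vertices: "(x, y) \<in> R \<Longrightarrow> x \<in> vertices \<G> \<and> y \<in> vertices \<G>"
  using equiv_type[OF equiv] by auto

lemma edge_iff: "{x, y} \<in> edges \<G> \<longleftrightarrow> (x, y) \<in> R \<and> x \<noteq> y"
  unfolding edges_eq by (auto simp: doubleton_eq_iff intro: R_sym)

lemma finite_class: "finite (R `` {x})"
  using finite_vertices by (rule finite_subset[rotated]) (auto dest: R_vertices)

lemma m_pos: "m \<ge> 1"
proof -
  obtain x where x: "x \<in> vertices \<G>" using vertices_nonempty by auto
  then have "R `` {x} \<noteq> {}" using R_refl by auto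
  then show ?thesis using card_class[OF x] finite_class[of x] by (metis One_nat_def Suc_leI card_gt_0_iff)
qed

section \<open>Vertex indices, degrees and the edge count\<close>

lemma vx_bij: "bij_betw vx {..<N} (vertices \<G>)"
  using vertex_enum[OF finite_vertices] by (metis bij_betw_nth)

lemma vx_in: "i < N \<Longrightarrow> vx i \<in> vertices \<G>"
  using vx_bij by (auto simp: bij_betw_def)

lemma vx_eq_iff: "i < N \<Longrightarrow> j < N \<Longrightarrow> vx i = vx j \<longleftrightarrow> i = j"
  using vx_bij by (auto simp: bij_betw_def dest: inj_onD)

lemma card_class_indices:
  assumes i: "i < N"
  shows "card {j. j < N \<and> (vx i, vx j) \<in> R} = m"
proof -
  have "bij_betw vx {j. j < N \<and> (vx i, vx j) \<in> R} (R `` {vx i})"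
    using vx_bij by (rule bij_betw_subset) (use vx_bij in \<open>auto simp: bij_betw_def dest: R_vertices\<close>)
  then show ?thesis by (simp add: bij_betw_same_card card_class vx_in i)
qed

lemma vertex_degree_eq:
  assumes x: "x \<in> vertices \<G>"
  shows "vertex_degree \<G> x = m - 1"
proof -
  have "{e \<in> edges \<G>. x \<in> e} = (\<lambda>y. {x, y}) ` (R `` {x} - {x})"
    unfolding edges_eq by (auto intro: R_sym)
  moreover have "inj_on (\<lambda>y. {x, y}) (R `` {x} - {x})"
    by (auto simp: inj_on_def doubleton_eq_iff)
  ultimately show ?thesis
    using card_class[OF x] R_refl[OF x] finite_class
    by (simp add: vertex_degree_def card_image)
qed

text \<open>Handshake count: each edge contains two vertices and each vertex lies on
  \<open>m - 1\<close> edges.\<close>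

lemma average_degree_eq: "average_degree \<G> = real m - 1"
proof -
  have "finite (edges \<G>)"
    using finite_vertices by (rule finite_subset[rotated, OF finite_Pow_iff[THEN iffD2]])
      (auto simp: edges_eq dest: R_vertices)
  moreover have "card {x \<in> vertices \<G>. x \<in> e} = 2" if e: "e \<in> edges \<G>" for e
  proof -
    obtain x y where "e = {x, y}" "(x, y) \<in> R" "x \<noteq> y" using e by (auto simp: edges_eq)
    moreover from this have "{x \<in> vertices \<G>. x \<in> e} = {x, y}" by (auto dest: R_vertices)
    ultimately show ?thesis by simp
  qed
  ultimately have "(\<Sum>x\<in>vertices \<G>. card {e \<in> edges \<G>. x \<in> e}) = 2 * card (edges \<G>)"
    by (intro sum_multicount finite_vertices) auto
  also have "(\<Sum>x\<in>vertices \<G>. card {e \<in> edges \<G>. x \<in> e}) = N * (m - 1)"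
    using vertex_degree_eq by (simp add: vertex_degree_def)
  finally have "2 * real (card (edges \<G>)) = real N * real (m - 1)"
    by (metis of_nat_mult of_nat_numeral)
  moreover have "N \<noteq> 0" using finite_vertices vertices_nonempty by simp
  ultimately show ?thesis using m_pos by (simp add: average_degree_def of_nat_diff)
qed

section \<open>Spectrum of the adjacency matrix\<close>

lemma adjacency_mat_carrier: "adjacency_mat \<G> \<in> carrier_mat N N"
  by (simp add: adjacency_mat_def)

lemma trace_adjacency_mat: "(\<Sum>i<N. adjacency_mat \<G> $$ (i, i)) = 0"
  using edge_iff by (intro sum.neutral) (auto simp: adjacency_mat_def)

lemma degree_mat_eq: "degree_mat \<G> = (of_nat m - 1) \<cdot>\<^sub>m 1\<^sub>m N"
  using m_pos by (intro eq_matI) (auto simp: degree_mat_def vertex_degree_eq[OF vx_in] of_nat_diff)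

text \<open>
  The sum of an eigenvector over the class of \<open>i\<close> is \<open>\<theta> + 1\<close> times its \<open>i\<close>-th entry, so for
  \<open>\<theta> \<noteq> -1\<close> the eigenvector is constant on classes.
\<close>
lemma eigenvalue_adjacency_mat:
  assumes "eigenvalue (adjacency_mat \<G>) \<theta>"
  shows "\<theta> = -1 \<or> \<theta> = of_nat m - 1"
proof (rule disjCI)
  assume m1: "\<theta> \<noteq> of_nat m - 1"
  let ?C = "\<lambda>i. {j. j < N \<and> (vx i, vx j) \<in> R}"
  obtain x where x: "x \<in> carrier_vec N" "x \<noteq> 0\<^sub>v N"
    and eq: "adjacency_mat \<G> *\<^sub>v x = \<theta> \<cdot>\<^sub>v x"
    using assms adjacency_mat_carrier by (auto simp: eigenvalue_def eigenvector_def)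
  have S: "(\<theta> + 1) * x $ i = (\<Sum>j\<in>?C i. x $ j)" if i: "i < N" for i
  proof -
    have "\<theta> * x $ i = (adjacency_mat \<G> *\<^sub>v x) $ i" using eq i x by simp
    also have "\<dots> = (\<Sum>j<N. (if {vx i, vx j} \<in> edges \<G> then 1 else 0) * x $ j)"
      using i x by (auto simp: adjacency_mat_def scalar_prod_def lessThan_atLeast0 intro!: sum.cong)
    \<comment> \<open>Row \<open>i\<close> of the matrix is supported on the class without
      \<open>i\<close> itself; adding the missing entry turns the factor \<theta> into \<theta> +
      1.\<close>
    also have "\<dots> = (\<Sum>j\<in>?C i - {i}. x $ j)"
      using i by (intro sum.mono_neutral_cong_right) (auto simp: edge_iff vx_eq_iff)
    finally show ?thesis
      using i R_refl[OF vx_in[OF i]] by (subst sum.remove[of _ i]) (auto simp: algebra_simps)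
  qed
  obtain i where i: "i < N" and xi: "x $ i \<noteq> 0"
    using x by (metis carrier_vecD eq_vecI index_zero_vec)
  show "\<theta> = -1"
  proof (rule ccontr)
    assume "\<theta> \<noteq> -1"
    then have l: "\<theta> + 1 \<noteq> 0" by (metis add_eq_0_iff2)
    have "x $ j = x $ i" if "j \<in> ?C i" for j
    proof -
      have "?C j = ?C i" using that by (auto intro: R_trans R_sym)
      then have "(\<theta> + 1) * x $ j = (\<theta> + 1) * x $ i" using S[OF i] S[of j] that by simp
      then show ?thesis using l by simp
    qed
    \<comment> \<open>The class sum consists of \<open>m\<close> equal entries, and the nonzero
      \<open>x $ i\<close> can then be cancelled.\<close>
    then have "(\<theta> + 1) * x $ i = of_nat m * x $ i"
      using S[OF i] card_class_indices[OF i] by simp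
    then have "\<theta> + 1 = of_nat m" using xi by simp
    then show False using m1 by (simp add: eq_diff_eq)
  qed
qed

text \<open>The resulting value depends neither on the shift \<open>c\<close> nor on the unit
  \<open>s\<close>; this is why the three energies coincide.\<close>

lemmas eigenvalue_sum_shifted_adjacency_mat =
  eigenvalue_sum_affine_mat[OF adjacency_mat_carrier trace_adjacency_mat
    eigenvalue_adjacency_mat m_pos]

lemma energy_eq: "energy \<G> = 2 * real N * (real m - 1) / real m"
proof -
  have "adjacency_mat \<G> = 0 \<cdot>\<^sub>m 1\<^sub>m N + 1 \<cdot>\<^sub>m adjacency_mat \<G>"
    using adjacency_mat_carrier by (intro eq_matI) auto
  then show ?thesis
    using eigenvalue_sum_shifted_adjacency_mat[of 1 0] by (simp add: energy_def)
qed

text \<open>By regularity the scalar degree matrix equals the average degree times the identity, so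
  it is exactly the shift subtracted in the energy.\<close>

lemma laplacian_energy_eq: "laplacian_energy \<G> = 2 * real N * (real m - 1) / real m"
proof -
  have "laplacian_mat \<G> = (of_nat m - 1) \<cdot>\<^sub>m 1\<^sub>m N + (- 1) \<cdot>\<^sub>m adjacency_mat \<G>"
    unfolding laplacian_mat_def degree_mat_eq
    using adjacency_mat_carrier by (intro eq_matI) auto
  then show ?thesis
    using eigenvalue_sum_shifted_adjacency_mat[of "-1" "of_nat m - 1"]
    by (simp add: laplacian_energy_def average_degree_eq)
qed

lemma signless_laplacian_energy_eq:
  "signless_laplacian_energy \<G> = 2 * real N * (real m - 1) / real m"
proof -
  have "signless_laplacian_mat \<G> = (of_nat m - 1) \<cdot>\<^sub>m 1\<^sub>m N + 1 \<cdot>\<^sub>m adjacency_mat \<G>"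
    unfolding signless_laplacian_mat_def degree_mat_eq
    using adjacency_mat_carrier by (intro eq_matI) auto
  then show ?thesis
    using eigenvalue_sum_shifted_adjacency_mat[of 1 "of_nat m - 1"]
    by (simp add: signless_laplacian_energy_def average_degree_eq)
qed

end

section \<open>The commuting graph of the unitriangular group\<close>

lemma V_eq_iff: "V a b c = V a' b' c' \<longleftrightarrow> a = a' \<and> b = b' \<and> c = c'"
proof
  assume eq: "V a b c = V a' b' c'"
  have "V a b c $$ (1, 0) = a" "V a b c $$ (2, 0) = b" "V a b c $$ (2, 1) = c" for a b c :: 'a
    by (simp_all add: V_def mat_of_rows_list_def)
  then show "a = a' \<and> b = b' \<and> c = c'" using eq by metis
qed auto

text \<open>The two products can differ only in the lower left entry, where the difference is the
  determinant \<open>c * a' - c' * a\<close>; the entries \<open>b\<close> and \<open>b'\<close> do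
  not matter.\<close>

lemma V_commute_iff: "V a b c * V a' b' c' = V a' b' c' * V a b c \<longleftrightarrow> c * a' = c' * a"
  by (auto simp: V_mult V_eq_iff algebra_simps)

lemma vertices_commuting_graph_unitriangular:
  "vertices (commuting_graph unitriangular_group) =
    {V a b c | a b c. a \<noteq> (0 :: 'F::field) \<or> c \<noteq> 0}"
proof -
  have "V a b c \<in> center unitriangular_group \<longleftrightarrow> a = 0 \<and> c = 0" for a b c :: 'F
  proof
    assume "V a b c \<in> center unitriangular_group"
    then have "V a b c * V a' 0 c' = V a' 0 c' * V a b c" for a' c'
      unfolding center_def unitriangular_group_def by auto
    then have "c * a' = c' * a" for a' c' by (simp add: V_commute_iff)
    \<comment> \<open>Testing against \<open>V 1 0 0\<close> forces \<open>c = 0\<close>, and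
      against \<open>V 0 0 1\<close> forces \<open>a = 0\<close>.\<close>
    from this[of 1 0] this[of 0 1] show "a = 0 \<and> c = 0" by simp
  qed (auto simp: center_def unitriangular_group_def V_commute_iff)
  moreover have "carrier unitriangular_group = {V a b c | a b c :: 'F. True}"
    by (simp add: unitriangular_group_def)
  ultimately show ?thesis by (auto simp: commuting_graph_def V_eq_iff)
qed

text \<open>Parametrization for counting. The set difference removes the whole product
  \<open>{0} \<times> UNIV \<times> {0}\<close>, the parameters of the center, from all
  triples.\<close>

lemma vertices_commuting_graph_unitriangular_image:
  "vertices (commuting_graph unitriangular_group) =
    (\<lambda>(a, b, c). V a b c) ` (UNIV - {0 :: 'F::field} \<times> UNIV \<times> {0})" (is "?L = ?f ` ?S")
proof
  show "?L \<subseteq> ?f ` ?S"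
  proof
    fix x assume "x \<in> ?L"
    then obtain a b c where "x = ?f (a, b, c)" "(a, b, c) \<in> ?S"
      by (auto simp: vertices_commuting_graph_unitriangular)
    then show "x \<in> ?f ` ?S" by (rule image_eqI)
  qed
qed (auto simp: vertices_commuting_graph_unitriangular)

text \<open>Nonzero vectors of the plane with vanishing determinant are proportional;
  \<open>t\<close> is the quotient of coordinates at a position where \<open>(a, c)\<close> is
  nonzero.\<close>

lemma cross_mult_eq_iff_multiple:
  fixes a c a' c' :: "'F::field"
  assumes "a \<noteq> 0 \<or> c \<noteq> 0" "a' \<noteq> 0 \<or> c' \<noteq> 0"
  shows "c * a' = c' * a \<longleftrightarrow> (\<exists>t. t \<noteq> 0 \<and> a' = t * a \<and> c' = t * c)"
proof
  assume eq: "c * a' = c' * a"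
  show "\<exists>t. t \<noteq> 0 \<and> a' = t * a \<and> c' = t * c"
  proof (cases "a = 0")
    case True
    then show ?thesis using eq assms by (intro exI[of _ "c' / c"]) auto
  next
    case False
    then have "c' = a' / a * c" using eq by (simp add: field_simps)
    \<comment> \<open>The factor is nonzero, since \<open>a' = 0\<close> would give
      \<open>c' = 0\<close> as well.\<close>
    then show ?thesis using False assms by (intro exI[of _ "a' / a"]) auto
  qed
qed auto

section \<open>Sizes of the vertex set and of the cliques\<close>

lemma card_vertices_commuting_graph_unitriangular:
  "card (vertices (commuting_graph (unitriangular_group :: 'F::{field, finite} mat monoid))) =
    CARD('F) ^ 3 - CARD('F)"
proof -
  let ?S = "UNIV - {0} \<times> UNIV \<times> {0} :: ('F \<times> 'F \<times> 'F) set"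
  have "inj_on (\<lambda>(a, b, c). V a b c) ?S" by (auto simp: inj_on_def V_eq_iff)
  moreover have "card ?S = CARD('F) ^ 3 - CARD('F)"
    by (subst card_Diff_subset) (auto simp: card_cartesian_product card_prod power3_eq_cube)
  ultimately show ?thesis
    by (simp add: vertices_commuting_graph_unitriangular_image card_image)
qed

text \<open>A class consists of the nonzero multiples of \<open>(a, c)\<close> with an arbitrary
  middle parameter \<open>b'\<close>. As \<open>(a, c)\<close> is nonzero, the scalar is determined,
  which leaves \<open>q - 1\<close> choices for it and \<open>q\<close> for
  \<open>b'\<close>.\<close>

lemma card_commuting_class_unitriangular:
  fixes a b c :: "'F::{field, finite}"
  assumes ac: "a \<noteq> 0 \<or> c \<noteq> 0"
  shows "card {y \<in> vertices (commuting_graph unitriangular_group). V a b c * y = y * V a b c} =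
    (CARD('F) - 1) * CARD('F)"
proof -
  let ?T = "(UNIV - {0}) \<times> UNIV :: ('F \<times> 'F) set"
  have "{y \<in> vertices (commuting_graph unitriangular_group). V a b c * y = y * V a b c} =
      (\<lambda>(t, b'). V (t * a) b' (t * c)) ` ?T" (is "?L = ?R")
  proof
    show "?L \<subseteq> ?R"
    proof
      fix y assume "y \<in> ?L"
      then obtain a' b' c' where "y = V a' b' c'" "a' \<noteq> 0 \<or> c' \<noteq> 0" "c * a' = c' * a"
        by (auto simp: vertices_commuting_graph_unitriangular V_commute_iff)
      then show "y \<in> ?R"
        using cross_mult_eq_iff_multiple[OF ac, of a' c'] by (auto simp: image_iff)
    qed
    show "?R \<subseteq> ?L"
      using ac by (auto simp: vertices_commuting_graph_unitriangular V_commute_iff V_eq_iff)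
  qed
  moreover have "inj_on (\<lambda>(t, b'). V (t * a) b' (t * c)) ?T"
    using ac by (auto simp: inj_on_def V_eq_iff)
  ultimately show ?thesis
    by (simp add: card_image card_cartesian_product card_Diff_subset)
qed

lemma clique_union_commuting_graph_unitriangular:
  fixes G :: "'F::{field, finite} mat monoid"
  defines "G \<equiv> unitriangular_group"
  shows "clique_union (commuting_graph G)
    {(x, y). x \<in> vertices (commuting_graph G) \<and> y \<in> vertices (commuting_graph G) \<and> x * y = y * x}
    ((CARD('F) - 1) * CARD('F))"
    (is "clique_union ?\<G> ?R ?m")
proof
  note vs = vertices_commuting_graph_unitriangular[where 'F = 'F, folded G_def]
  show "finite (vertices ?\<G>)"
    by (simp add: G_def vertices_commuting_graph_unitriangular_image)
  have "V 1 0 0 \<in> vertices ?\<G>" by (simp add: vs V_eq_iff)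
  then show "vertices ?\<G> \<noteq> {}" by blast
  show "equiv (vertices ?\<G>) ?R"
  proof (rule equivI)
    show "trans ?R"
    proof (rule transI)
      fix x y z assume R: "(x, y) \<in> ?R" "(y, z) \<in> ?R"
      then have xyz: "x \<in> vertices ?\<G>" "y \<in> vertices ?\<G>" "z \<in> vertices ?\<G>" by auto
      then obtain a b c a' b' c' a'' b'' c'' where
        V: "x = V a b c" "y = V a' b' c'" "z = V a'' b'' c''"
        and n: "a' \<noteq> 0 \<or> c' \<noteq> 0"
        unfolding vs by blast
      have e: "c * a' = c' * a" "c' * a'' = c'' * a'"
        using R V by (simp_all add: V_commute_iff)
      \<comment> \<open>Transitivity rests on the middle element being non-central: the desired
        equation is derived after multiplication by \<open>a'\<close> and by \<open>c'\<close>, and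
        one of these can be cancelled.\<close>
      have "a' * (c * a'') = (c * a') * a''" by (simp only: ac_simps)
      also have "\<dots> = (c' * a'') * a" unfolding e(1) by (simp only: ac_simps)
      also have "\<dots> = a' * (c'' * a)" unfolding e(2) by (simp only: ac_simps)
      finally have a': "a' * (c * a'') = a' * (c'' * a)" .
      have "c' * (c * a'') = c * (c' * a'')" by (simp only: ac_simps)
      also have "\<dots> = (c * a') * c''" unfolding e(2) by (simp only: ac_simps)
      also have "\<dots> = c' * (c'' * a)" unfolding e(1) by (simp only: ac_simps)
      finally have "c' * (c * a'') = c' * (c'' * a)" .
      with a' have "c * a'' = c'' * a" using n by auto
      with V have "x * z = z * x" by (simp add: V_commute_iff)
      with xyz show "(x, z) \<in> ?R" by simp
    qed
  qed (auto simp: refl_on_def sym_def)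
  show "edges ?\<G> = {{x, y} | x y. (x, y) \<in> ?R \<and> x \<noteq> y}"
  proof -
    have mult: "x \<otimes>\<^bsub>G\<^esub> y = x * y" for x y by (simp add: G_def unitriangular_group_def)
    show ?thesis
      unfolding commuting_graph_def mult sgraph.simps by (rule Collect_cong) auto
  qed
  show "card (?R `` {x}) = ?m" if x: "x \<in> vertices ?\<G>" for x
  proof -
    obtain a b c where "x = V a b c" "a \<noteq> 0 \<or> c \<noteq> 0" using x by (auto simp: vs)
    moreover have "?R `` {x} = {y \<in> vertices ?\<G>. x * y = y * x}" using x by auto
    ultimately show ?thesis
      using card_commuting_class_unitriangular[of a c b] by (simp add: G_def)
  qed
qed

theorem proposition2p13:
  fixes p n :: nat
    and G :: "'F::{field, finite} mat monoid"
  assumes "prime p"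
    and "CARD('F) = p ^ n"
    and "G = unitriangular_group"
  shows "energy (commuting_graph G) = 2 * (real p ^ (3 * n) - 2 * real p ^ n - 1) \<and>
         laplacian_energy (commuting_graph G) = 2 * (real p ^ (3 * n) - 2 * real p ^ n - 1) \<and>
         signless_laplacian_energy (commuting_graph G) =
           2 * (real p ^ (3 * n) - 2 * real p ^ n - 1)"
proof -
  interpret clique_union "commuting_graph G"
    "{(x, y). x \<in> vertices (commuting_graph G) \<and> y \<in> vertices (commuting_graph G) \<and> x * y = y * x}"
    "(CARD('F) - 1) * CARD('F)"
    unfolding assms(3) by (rule clique_union_commuting_graph_unitriangular)
  define q where "q = CARD('F)"
  \<comment> \<open>A field has at least the two elements 0 and 1; hence the clique size
    \<open>(q - 1) * q\<close> is a nonzero divisor below.\<close>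
  have "card {0, 1 :: 'F} \<le> q" unfolding q_def by (intro card_mono) auto
  then have q: "q \<ge> 2" by simp
  \<comment> \<open>Ensures that the natural subtraction in the vertex count does not
    truncate.\<close>
  have "q \<le> q ^ 3" using q by (intro self_le_power) auto
  then have N: "real N = real q ^ 3 - real q"
    by (simp add: assms(3) card_vertices_commuting_graph_unitriangular of_nat_diff flip: q_def)
  have m: "real ((q - 1) * q) = (real q - 1) * real q" using q by (simp add: of_nat_diff)
  have qp: "real p ^ n = real q" "real p ^ (3 * n) = real q ^ 3"
    using assms(2) by (simp_all add: q_def power_mult mult.commute[of 3])
  \<comment> \<open>Since \<open>q ^ 3 - q = (q + 1) * ((q - 1) * q)\<close>, there are
    \<open>q + 1\<close> cliques, one per line of the plane, and the left side is
    \<open>2 * (q + 1) * (q ^ 2 - q - 1)\<close>.\<close>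
  have "2 * real N * (real ((q - 1) * q) - 1) / real ((q - 1) * q) = 2 * (real q ^ 3 - 2 * real q - 1)"
    unfolding N m using q by (simp add: divide_simps) (simp add: algebra_simps power3_eq_cube)
  then show ?thesis
    unfolding energy_eq laplacian_energy_eq signless_laplacian_energy_eq qp q_def by simp
qed

end
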